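(* Let $(X,\kappa_1,\kappa_2)$ be a bispace which is pairwise semi-symmetric and pairwise semi-$T_0$. Then $(X,\kappa_1,\kappa_2)$ is pairwise semi-$T_1$.
   Context: A $\sigma$-space $(X,\kappa)$ is a nonempty set $X$ with a family $\kappa$ of subsets of $X$ (the $\kappa$-open sets) such that $\emptyset,X\in\kappa$, and $\kappa$ is closed under countable unions and finite intersections; complements of $\kappa$-open sets are $\kappa$-closed. A bispace $(X,\kappa_1,\kappa_2)$ is a nonempty set $X$ with two families $\kappa_1,\kappa_2$ such that $(X,\kappa_1)$ and $(X,\kappa_2)$ are $\sigma$-spaces. For $i\in\{1,2\}$, the $\kappa_i$-closure $\overline{G_{\kappa_i}}$ of $G\subseteq X$ is the intersection of all $\kappa_i$-closed sets containing $G$ (it need not be $\kappa_i$-closed). A set $B\subseteq X$ is $s\kappa_i$-open (semi $\kappa_i$-open) if there is a $\kappa_i$-open set $G$ with $G\subseteq B\subseteq\overline{G_{\kappa_i}}$; $B$ is $s\kappa_i$-closed if $X\setminus B$ is $s\kappa_i$-open. The semi $\kappa_i$-closure $\overline{sB_{\kappa_i}}$ of $B$ is the intersection of all $s\kappa_i$-closed sets containing $B$ (it need not be $s\kappa_i$-closed). Pairwise semi-$T_0$: for all $x,y\in X$ with $x\neq y$, either there is an $s\kappa_1$-open set $U$ with $x\in U$, $y\notin U$, or there is an $s\kappa_2$-open set $V$ with $y\in V$, $x\notin V$. Pairwise semi-$T_1$: for all $x,y\in X$ with $x\neq y$ there exist an $s\kappa_1$-open set $U$ and an $s\kappa_2$-open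 set $V$ such that $x\in U$, $y\notin U$, $y\in V$, $x\notin V$. Pairwise semi-symmetric: for all $x,y\in X$ and all $i,j\in\{1,2\}$ with $i\neq j$, $x\in\overline{s\{y\}_{\kappa_i}}$ implies $y\in\overline{s\{x\}_{\kappa_j}}$. *)

theory Defs
  imports "HOL-Library.Countable_Set"
begin

definition sigma_space :: "'a set \<Rightarrow> 'a set set \<Rightarrow> bool" where
  "sigma_space X \<kappa> \<longleftrightarrow>
     X \<noteq> {} \<and> \<kappa> \<subseteq> Pow X \<and> {} \<in> \<kappa> \<and> X \<in> \<kappa> \<and>
     (\<forall>\<A>. \<A> \<subseteq> \<kappa> \<and> countable \<A> \<longrightarrow> \<Union>\<A> \<in> \<kappa>) \<and>
     (\<forall>\<A>. \<A> \<subseteq> \<kappa> \<and> finite \<A> \<and> \<A> \<noteq> {} \<longrightarrow> \<Inter>\<A> \<in> \<kappa>)"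

definition bispace :: "'a set \<Rightarrow> 'a set set \<Rightarrow> 'a set set \<Rightarrow> bool" where
  "bispace X \<kappa>\<^sub>1 \<kappa>\<^sub>2 \<longleftrightarrow> X \<noteq> {} \<and> sigma_space X \<kappa>\<^sub>1 \<and> sigma_space X \<kappa>\<^sub>2"

definition kappa_closed :: "'a set \<Rightarrow> 'a set set \<Rightarrow> 'a set \<Rightarrow> bool" where
  "kappa_closed X \<kappa> F \<longleftrightarrow> F \<subseteq> X \<and> X - F \<in> \<kappa>"

definition kappa_closure :: "'a set \<Rightarrow> 'a set set \<Rightarrow> 'a set \<Rightarrow> 'a set" where
  "kappa_closure X \<kappa> G = \<Inter>{F. kappa_closed X \<kappa> F \<and> G \<subseteq> F}"

definition semi_open :: "'a set \<Rightarrow> 'a set set \<Rightarrow> 'a set \<Rightarrow> bool" where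
  "semi_open X \<kappa> B \<longleftrightarrow> B \<subseteq> X \<and> (\<exists>G\<in>\<kappa>. G \<subseteq> B \<and> B \<subseteq> kappa_closure X \<kappa> G)"

definition semi_closed :: "'a set \<Rightarrow> 'a set set \<Rightarrow> 'a set \<Rightarrow> bool" where
  "semi_closed X \<kappa> B \<longleftrightarrow> B \<subseteq> X \<and> semi_open X \<kappa> (X - B)"

definition semi_closure :: "'a set \<Rightarrow> 'a set set \<Rightarrow> 'a set \<Rightarrow> 'a set" where
  "semi_closure X \<kappa> B = \<Inter>{F. semi_closed X \<kappa> F \<and> B \<subseteq> F}"

definition pairwise_semi_T0 :: "'a set \<Rightarrow> 'a set set \<Rightarrow> 'a set set \<Rightarrow> bool" where
  "pairwise_semi_T0 X \<kappa>\<^sub>1 \<kappa>\<^sub>2 \<longleftrightarrow>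
     (\<forall>x\<in>X. \<forall>y\<in>X. x \<noteq> y \<longrightarrow>
        (\<exists>U. semi_open X \<kappa>\<^sub>1 U \<and> x \<in> U \<and> y \<notin> U) \<or>
        (\<exists>V. semi_open X \<kappa>\<^sub>2 V \<and> y \<in> V \<and> x \<notin> V))"

definition pairwise_semi_T1 :: "'a set \<Rightarrow> 'a set set \<Rightarrow> 'a set set \<Rightarrow> bool" where
  "pairwise_semi_T1 X \<kappa>\<^sub>1 \<kappa>\<^sub>2 \<longleftrightarrow>
     (\<forall>x\<in>X. \<forall>y\<in>X. x \<noteq> y \<longrightarrow>
        (\<exists>U V. semi_open X \<kappa>\<^sub>1 U \<and> semi_open X \<kappa>\<^sub>2 V \<and>
               x \<in> U \<and> y \<notin> U \<and> y \<in> V \<and> x \<notin> V))"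

(* The two conjuncts are the cases (i, j) = (1, 2) and (i, j) = (2, 1). *)
definition pairwise_semi_symmetric :: "'a set \<Rightarrow> 'a set set \<Rightarrow> 'a set set \<Rightarrow> bool" where
  "pairwise_semi_symmetric X \<kappa>\<^sub>1 \<kappa>\<^sub>2 \<longleftrightarrow>
     (\<forall>x\<in>X. \<forall>y\<in>X.
        (x \<in> semi_closure X \<kappa>\<^sub>1 {y} \<longrightarrow> y \<in> semi_closure X \<kappa>\<^sub>2 {x}) \<and>
        (x \<in> semi_closure X \<kappa>\<^sub>2 {y} \<longrightarrow> y \<in> semi_closure X \<kappa>\<^sub>1 {x}))"

end

theory Submission
  imports Defs
begin

text \<open>
  An \<open>s\<kappa>\<close>-open set separates \<open>x\<close> from \<open>y\<close> exactly when \<open>x\<close> lies outside the semi-closure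
  of \<open>{y}\<close>. Under this dictionary (\<open>not_in_semi_closure_singleton_iff\<close>), for distinct points
  \<open>x\<close> and \<open>y\<close> both separation axioms speak of the same two statements: \<open>x\<close> is outside the
  \<open>\<kappa>\<^sub>1\<close>-semi-closure of \<open>{y}\<close>, and \<open>y\<close> is outside the \<open>\<kappa>\<^sub>2\<close>-semi-closure of \<open>{x}\<close>. Pairwise
  semi-\<open>T\<^sub>0\<close> asserts their disjunction and pairwise semi-\<open>T\<^sub>1\<close> their conjunction, while
  semi-symmetry makes them equivalent, so the disjunction already forces the conjunction.
\<close>

text \<open>
  Complements in \<open>X\<close> exchange the semi-open sets containing \<open>x\<close> but not \<open>y\<close> with the
  semi-closed sets containing \<open>y\<close> but not \<open>x\<close>; some set of the latter kind exists iff \<open>x\<close>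
  is missing from the intersection that defines the semi-closure.
\<close>
lemma not_in_semi_closure_singleton_iff:
  assumes "x \<in> X" and "y \<in> X"
  shows "x \<notin> semi_closure X \<kappa> {y} \<longleftrightarrow> (\<exists>U. semi_open X \<kappa> U \<and> x \<in> U \<and> y \<notin> U)"
proof
  assume "x \<notin> semi_closure X \<kappa> {y}"
  then obtain F where "semi_closed X \<kappa> F" "y \<in> F" "x \<notin> F"
    unfolding semi_closure_def by blast
  then have "semi_open X \<kappa> (X - F)" "x \<in> X - F" "y \<notin> X - F"
    using assms by (auto simp: semi_closed_def)
  then show "\<exists>U. semi_open X \<kappa> U \<and> x \<in> U \<and> y \<notin> U"
    by blast
next
  assume "\<exists>U. semi_open X \<kappa> U \<and> x \<in> U \<and> y \<notin> U"
  then obtain U where U: "semi_open X \<kappa> U" "x \<in> U" "y \<notin> U"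
    by blast
  then have "X - (X - U) = U"
    by (auto simp: semi_open_def)
  with U have "semi_closed X \<kappa> (X - U)"
    by (simp add: semi_closed_def)
  moreover have "y \<in> X - U" "x \<notin> X - U"
    using U assms by auto
  ultimately show "x \<notin> semi_closure X \<kappa> {y}"
    unfolding semi_closure_def by blast
qed

theorem theorem3p16:
  fixes X :: "'a set" and \<kappa>\<^sub>1 \<kappa>\<^sub>2 :: "'a set set"
  assumes "bispace X \<kappa>\<^sub>1 \<kappa>\<^sub>2"
    and "pairwise_semi_symmetric X \<kappa>\<^sub>1 \<kappa>\<^sub>2"
    and "pairwise_semi_T0 X \<kappa>\<^sub>1 \<kappa>\<^sub>2"
  shows "pairwise_semi_T1 X \<kappa>\<^sub>1 \<kappa>\<^sub>2"
  unfolding pairwise_semi_T1_def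
proof (intro ballI impI)
  fix x y
  assume xy: "x \<in> X" "y \<in> X" "x \<noteq> y"
  have "x \<notin> semi_closure X \<kappa>\<^sub>1 {y} \<or> y \<notin> semi_closure X \<kappa>\<^sub>2 {x}"
    using assms(3) xy by (simp add: pairwise_semi_T0_def not_in_semi_closure_singleton_iff)
  moreover have "x \<in> semi_closure X \<kappa>\<^sub>1 {y} \<longleftrightarrow> y \<in> semi_closure X \<kappa>\<^sub>2 {x}"
    using assms(2) xy unfolding pairwise_semi_symmetric_def by blast
  ultimately have "x \<notin> semi_closure X \<kappa>\<^sub>1 {y}" "y \<notin> semi_closure X \<kappa>\<^sub>2 {x}"
    by blast+
  then show "\<exists>U V. semi_open X \<kappa>\<^sub>1 U \<and> semi_open X \<kappa>\<^sub>2 V \<and>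
               x \<in> U \<and> y \<notin> U \<and> y \<in> V \<and> x \<notin> V"
    using xy by (auto simp: not_in_semi_closure_singleton_iff)
qed

end
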